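(* Let $F_t$ be a semi-linear, but not linear, one-parameter similarity family in $\mathbb{R}^2$. If there is a function in $F_t$ whose linear part has maximum scaling ratio among the functions in $F_t$ and whose rotation angle is an irrational multiple of $\pi$, then there is a $\tau<t_0$ such that the attractor $A_t$ of $F_t$ has non-empty interior for all $t\in(\tau,t_0)$.
   Context: A function $f:\mathbb{R}^2\to\mathbb{R}^2$ is affine if $f(x)=Lx+a$, where $L$ is a non-singular $2\times 2$ real matrix (the linear part of $f$) and $a\in\mathbb{R}^2$. A one-parameter affine family in $\mathbb{R}^2$ is given by $N\ge 2$ affine functions $F=\{f_1,\dots,f_N\}$ on $\mathbb{R}^2$ and vectors $q_1,\dots,q_N\in\mathbb{R}^2$; for each real $t\ge 0$ it is $F_t=\{f_{(i,t)} : 1\le i\le N\}$ with $f_{(i,t)}(x)=t f_i(x)+q_i$. It is a similarity family if each function is a similarity transformation. The Hutchinson operator of $F_t$ on non-empty compact sets is $F_t(K)=\bigcup_{f\in F_t} f(K)$. A non-empty compact set $A_t$ is the attractor of $F_t$ if $A_t=\lim_{k\to\infty}F_t^k(K)$ in the Hausdorff metric for every non-empty compact $K$. If $L_1,\dots,L_N$ are the linear parts of $f_1,\dots,f_N$, the joint spectral radius of $F$ is $\rho(F)=\limsup_{k\to\infty}\big(\max\|L_{i_1}\cdots L_{i_k}\|\big)^{1/k}$, the maximum being over all words of length $k$ in $\{1,\dots,N\}$. Set $t_0=1/\rho(F)$; the attractor $A_t$ exists exactly for $t\in[0,t_0)$. Functions $f,g$ are conjugate by a function $h$ if $g=h^{-1}fh$.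 The family $F_t$ is linear if, for all $i$ and all $t\in[0,t_0)$, $f_{(i,t)}$ is conjugate to a linear function by a function $h$ independent of $i$ and $t$; it is semi-linear if, for all $i$ and all $t\in[0,t_0)$, $f_{(i,t)}$ is conjugate to a linear function by a function $h_i$ independent of $t$. *)

theory Defs
  imports "HOL-Analysis.Analysis"
begin

text \<open>A family is given by the number \<open>N\<close>, the functions \<open>f i\<close> and the vectors \<open>q i\<close>,
  where only the indices \<open>1 \<le> i \<le> N\<close> matter. The functions need not be distinct.\<close>

definition affine_map :: "(real^2 \<Rightarrow> real^2) \<Rightarrow> bool" where
  "affine_map g \<longleftrightarrow> (\<exists>(L::real^2^2) a. invertible L \<and> (\<forall>x. g x = L *v x + a))"

definition linear_part :: "(real^2 \<Rightarrow> real^2) \<Rightarrow> real^2^2" where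
  "linear_part g = (THE L. \<exists>a. \<forall>x. g x = L *v x + a)"

definition similarity_map :: "(real^2 \<Rightarrow> real^2) \<Rightarrow> bool" where
  "similarity_map g \<longleftrightarrow> (\<exists>r>0. \<forall>x y. dist (g x) (g y) = r * dist x y)"

definition affine_family :: "nat \<Rightarrow> (nat \<Rightarrow> real^2 \<Rightarrow> real^2) \<Rightarrow> bool" where
  "affine_family N f \<longleftrightarrow> 2 \<le> N \<and> (\<forall>i\<in>{1..N}. affine_map (f i))"

definition fam :: "(nat \<Rightarrow> real^2 \<Rightarrow> real^2) \<Rightarrow> (nat \<Rightarrow> real^2) \<Rightarrow> nat \<Rightarrow> real \<Rightarrow> real^2 \<Rightarrow> real^2" where
  "fam f q i t = (\<lambda>x. t *\<^sub>R f i x + q i)"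

text \<open>The parameter \<open>t = 0\<close> is left out because \<open>fam f q i 0\<close> is constant.\<close>

definition similarity_family ::
    "nat \<Rightarrow> (nat \<Rightarrow> real^2 \<Rightarrow> real^2) \<Rightarrow> (nat \<Rightarrow> real^2) \<Rightarrow> bool" where
  "similarity_family N f q \<longleftrightarrow> (\<forall>i\<in>{1..N}. \<forall>t>0. similarity_map (fam f q i t))"

definition hutchinson ::
    "nat \<Rightarrow> (nat \<Rightarrow> real^2 \<Rightarrow> real^2) \<Rightarrow> (nat \<Rightarrow> real^2) \<Rightarrow> real \<Rightarrow> (real^2) set \<Rightarrow> (real^2) set" where
  "hutchinson N f q t K = (\<Union>i\<in>{1..N}. fam f q i t ` K)"

text \<open>The Hausdorff metric; meaningful for non-empty compact sets only.\<close>

definition hausdorff_dist :: "(real^2) set \<Rightarrow> (real^2) set \<Rightarrow> real" where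
  "hausdorff_dist A B = max (SUP x\<in>A. infdist x B) (SUP y\<in>B. infdist y A)"

definition is_attractor ::
    "nat \<Rightarrow> (nat \<Rightarrow> real^2 \<Rightarrow> real^2) \<Rightarrow> (nat \<Rightarrow> real^2) \<Rightarrow> real \<Rightarrow> (real^2) set \<Rightarrow> bool" where
  "is_attractor N f q t A \<longleftrightarrow> compact A \<and> A \<noteq> {} \<and>
     (\<forall>K. compact K \<and> K \<noteq> {} \<longrightarrow>
        (\<lambda>k. hausdorff_dist ((hutchinson N f q t ^^ k) K) A) \<longlonglongrightarrow> 0)"

definition word_matrix :: "(nat \<Rightarrow> real^2 \<Rightarrow> real^2) \<Rightarrow> nat list \<Rightarrow> real^2^2" where
  "word_matrix f w = foldr (\<lambda>i M. linear_part (f i) ** M) w (mat 1)"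

text \<open>The operator norm is used; the value is the same for every matrix norm.\<close>

definition joint_spectral_radius :: "nat \<Rightarrow> (nat \<Rightarrow> real^2 \<Rightarrow> real^2) \<Rightarrow> real" where
  "joint_spectral_radius N f = real_of_ereal (limsup (\<lambda>k. ereal (root k
     (Max ((\<lambda>w. onorm ((*v) (word_matrix f w))) ` {w. length w = k \<and> set w \<subseteq> {1..N}})))))"

definition t0 :: "nat \<Rightarrow> (nat \<Rightarrow> real^2 \<Rightarrow> real^2) \<Rightarrow> real" where
  "t0 N f = 1 / joint_spectral_radius N f"

definition conjugate_by ::
    "(real^2 \<Rightarrow> real^2) \<Rightarrow> (real^2 \<Rightarrow> real^2) \<Rightarrow> (real^2 \<Rightarrow> real^2) \<Rightarrow> bool" where
  "conjugate_by h g g' \<longleftrightarrow> bij h \<and> g' = inv h \<circ> g \<circ> h"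

text \<open>A linear function may be singular here: at \<open>t = 0\<close> the functions are constant, and the only
  linear function conjugate to a constant one is \<open>0\<close>. Any bijection is allowed as \<open>h\<close>; since
  \<open>h 0\<close> must be a fixed point of \<open>fam f q i t\<close> for all \<open>t\<close>, the notions
  do not change if \<open>h\<close> is restricted to translations.\<close>

definition linear_family ::
    "nat \<Rightarrow> (nat \<Rightarrow> real^2 \<Rightarrow> real^2) \<Rightarrow> (nat \<Rightarrow> real^2) \<Rightarrow> bool" where
  "linear_family N f q \<longleftrightarrow>
     (\<exists>h. \<forall>i\<in>{1..N}. \<forall>t\<in>{0..<t0 N f}. \<exists>g. linear g \<and> conjugate_by h (fam f q i t) g)"

definition semi_linear_family ::
    "nat \<Rightarrow> (nat \<Rightarrow> real^2 \<Rightarrow> real^2) \<Rightarrow> (nat \<Rightarrow> real^2) \<Rightarrow> bool" where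
  "semi_linear_family N f q \<longleftrightarrow>
     (\<forall>i\<in>{1..N}. \<exists>h. \<forall>t\<in>{0..<t0 N f}. \<exists>g. linear g \<and> conjugate_by h (fam f q i t) g)"

definition scaling_ratio :: "real^2^2 \<Rightarrow> real" where
  "scaling_ratio L = (THE r. \<forall>x. norm (L *v x) = r * norm x)"

text \<open>Only non-zero orientation preserving similarities have a rotation angle; it is determined
  modulo \<open>2 * pi\<close>, so being an irrational multiple of \<open>pi\<close> does not depend on the choice.\<close>

definition has_rotation_angle :: "real^2^2 \<Rightarrow> real \<Rightarrow> bool" where
  "has_rotation_angle L \<theta> \<longleftrightarrow>
     (\<exists>r>0. L = r *\<^sub>R vector [vector [cos \<theta>, - sin \<theta>], vector [sin \<theta>, cos \<theta>]])"

end

theory Submission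
  imports Defs
begin

text \<open>
  Semi-linearity forces \<open>f i\<close> to vanish at \<open>q i\<close>, so every function of the family is
  \<open>x \<mapsto> q i + t L\<^sub>i (x - q i)\<close> with a centre \<open>q i\<close> independent of \<open>t\<close>, and a family that is
  not linear has two different centres. Let \<open>g\<^sub>1\<close> be the function with the largest ratio
  and an irrational rotation angle \<open>\<theta>\<close>, let \<open>p\<close> be its centre, and let \<open>g\<^sub>2\<close> be a function
  with another centre and ratio \<open>s\<close>. Write \<open>\<rho>\<close> for the ratio of \<open>g\<^sub>1\<close>. As \<open>t\<close> tends to
  \<open>t0\<close>, the reciprocal of the largest ratio among the \<open>f i\<close>, the number \<open>\<rho>\<close> tends to 1,
  whereas \<open>s\<close> stays above a positive constant.

  Let \<open>B\<close> be the closed disc about \<open>p\<close> whose boundary passes through \<open>g\<^sub>2 p\<close>, and let \<open>R\<close> be its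
  radius. The smaller disc \<open>g\<^sub>1 ` B\<close> covers \<open>B\<close> up to the annulus of width \<open>(1 - \<rho>) R\<close> along the
  boundary. The set \<open>(g\<^sub>1 ^^ n) ` g\<^sub>2 ` B\<close> is the disc of radius \<open>\<rho> ^ n s R\<close> about the point
  at distance \<open>\<rho> ^ n R\<close> from \<open>p\<close>, in the direction obtained by turning \<open>g\<^sub>2 p - p\<close> by \<open>n \<theta>\<close>.
  Finitely many multiples of \<open>\<theta>\<close> are as dense on the circle as required. Once \<open>\<rho>\<close> is close
  enough to 1, these finitely many centres stay near the boundary of \<open>B\<close> and their discs, of radius
  at least \<open>s R / 2\<close>, cover the annulus (\<open>rotated_images_fill_disc\<close>). All lengths here are
  proportional to \<open>R\<close>. This makes the estimate uniform in \<open>t\<close> even when \<open>R\<close> shrinks to 0 as \<open>t\<close>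
  tends to \<open>t0\<close>, which happens if the limit of \<open>g\<^sub>2\<close> fixes \<open>p\<close>.

  So every point of \<open>B\<close> is the image of some point of \<open>B\<close> under a contraction that maps
  the attractor into itself. By \<open>subset_of_contracting_cover\<close> the disc \<open>B\<close> lies in the attractor.
\<close>

section \<open>Contracting iterated function systems\<close>

lemma hutchinson_mono: "S \<subseteq> T \<Longrightarrow> hutchinson N f q t S \<subseteq> hutchinson N f q t T"
  unfolding hutchinson_def by blast

lemma iterate_hutchinson_mono:
  "S \<subseteq> T \<Longrightarrow> (hutchinson N f q t ^^ k) S \<subseteq> (hutchinson N f q t ^^ k) T"
  by (induction k) (simp_all add: hutchinson_mono)

text \<open>Applying the same functions in the same order to two nearby points contracts their distance;
  used in both directions, this bounds the Hausdorff distance between iterates.\<close>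

lemma iterate_hutchinson_close:
  assumes contr: "\<And>i x y. i \<in> {1..N} \<Longrightarrow> dist (fam f q i t x) (fam f q i t y) \<le> c * dist x y"
    and "0 \<le> c" and close: "\<And>x. x \<in> S \<Longrightarrow> \<exists>y\<in>T. dist x y \<le> C"
  shows "x \<in> (hutchinson N f q t ^^ k) S \<Longrightarrow>
           \<exists>y\<in>(hutchinson N f q t ^^ k) T. dist x y \<le> c ^ k * C"
proof (induction k arbitrary: x)
  case 0
  then show ?case using close by simp
next
  case (Suc k)
  from Suc.prems have "x \<in> hutchinson N f q t ((hutchinson N f q t ^^ k) S)" by simp
  then obtain i z where i: "i \<in> {1..N}" and z: "z \<in> (hutchinson N f q t ^^ k) S"
    and x: "x = fam f q i t z"
    unfolding hutchinson_def by blast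
  from Suc.IH[OF z] obtain y where y: "y \<in> (hutchinson N f q t ^^ k) T" "dist z y \<le> c ^ k * C"
    by blast
  have "dist x (fam f q i t y) \<le> c * dist z y" unfolding x by (rule contr[OF i])
  also have "\<dots> \<le> c * (c ^ k * C)" using y(2) \<open>0 \<le> c\<close> by (rule mult_left_mono)
  finally have "dist x (fam f q i t y) \<le> c ^ Suc k * C" by simp
  moreover have "fam f q i t y \<in> (hutchinson N f q t ^^ Suc k) T"
    using i y(1) unfolding hutchinson_def by auto
  ultimately show ?case by blast
qed

lemma hausdorff_dist_bounds:
  assumes "A \<noteq> {}" "B \<noteq> {}"
    and AB: "\<And>x. x \<in> A \<Longrightarrow> \<exists>y\<in>B. dist x y \<le> e"
    and BA: "\<And>y. y \<in> B \<Longrightarrow> \<exists>x\<in>A. dist y x \<le> e"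
  shows "0 \<le> hausdorff_dist A B" "hausdorff_dist A B \<le> e"
proof -
  have a: "infdist x B \<le> e" if "x \<in> A" for x using AB[OF that] infdist_le2 by blast
  have b: "infdist y A \<le> e" if "y \<in> B" for y using BA[OF that] infdist_le2 by blast
  obtain x where x: "x \<in> A" using assms(1) by blast
  have "bdd_above ((\<lambda>x. infdist x B) ` A)" using a by (auto intro!: bdd_aboveI)
  then have "0 \<le> (SUP x\<in>A. infdist x B)" by (rule cSUP_upper2[OF _ x infdist_nonneg])
  then show "0 \<le> hausdorff_dist A B" unfolding hausdorff_dist_def by simp
  show "hausdorff_dist A B \<le> e"
    unfolding hausdorff_dist_def using assms(1,2) a b by (auto intro!: cSUP_least)
qed

text \<open>A large disc \<open>D\<close> is mapped into itself, so its iterates decrease, and their intersection is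
  the attractor. Convergence needs only that this intersection is mapped into itself and is
  contained in every iterate of \<open>D\<close>: the iterates of any compact set approach it at a
  geometric rate.\<close>

theorem contracting_family_attractor:
  assumes N: "1 \<le> N" and c: "0 \<le> c" "c < 1"
    and contr: "\<And>i x y. i \<in> {1..N} \<Longrightarrow> dist (fam f q i t x) (fam f q i t y) \<le> c * dist x y"
  obtains A where "is_attractor N f q t A" "hutchinson N f q t A \<subseteq> A"
proof -
  let ?F = "hutchinson N f q t"
  \<comment> \<open>The radius solves \<open>c * R + b = R\<close>, where \<open>b\<close> bounds all images of the origin.\<close>
  define b where "b = (\<Sum>i\<in>{1..N}. norm (fam f q i t 0))"
  define R where "R = b / (1 - c)"
  define D where "D = cball (0::real^2) R"
  define A where "A = (\<Inter>k. (?F ^^ k) D)"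
  have b0: "0 \<le> b" unfolding b_def by (simp add: sum_nonneg)
  have R: "c * R + b = R" unfolding R_def using c by (simp add: field_simps)
  have R0: "0 \<le> R" unfolding R_def using b0 c by simp
  have FD: "?F D \<subseteq> D"
  proof
    fix x assume "x \<in> ?F D"
    then obtain i y where i: "i \<in> {1..N}" and y: "norm y \<le> R" and x: "x = fam f q i t y"
      by (auto simp: hutchinson_def D_def)
    have "norm (fam f q i t 0) \<le> b"
      unfolding b_def by (rule member_le_sum[OF i]) auto
    moreover have "norm (x - fam f q i t 0) \<le> c * R"
      using contr[OF i, of y 0] mult_left_mono[OF y c(1)] x by (simp add: dist_norm)
    moreover have "norm x \<le> norm (x - fam f q i t 0) + norm (fam f q i t 0)"
      by (metis diff_add_cancel norm_triangle_ineq)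
    ultimately have "norm x \<le> R" using R by linarith
    then show "x \<in> D" by (simp add: D_def)
  qed
  have cont: "continuous_on S (fam f q i t)" if "i \<in> {1..N}" for i S
  proof (rule continuous_onI)
    fix x e assume e: "0 < (e::real)"
    have "dist (fam f q i t x') (fam f q i t x) \<le> e" if "dist x' x < e" for x'
    proof -
      have "dist (fam f q i t x') (fam f q i t x) \<le> c * dist x' x"
        using contr[OF \<open>i \<in> {1..N}\<close>] .
      also have "\<dots> \<le> 1 * dist x' x" by (rule mult_right_mono) (use c in auto)
      finally show ?thesis using that by linarith
    qed
    with e show "\<exists>d>0. \<forall>x'\<in>S. dist x' x < d \<longrightarrow> dist (fam f q i t x') (fam f q i t x) \<le> e"
      by blast
  qed
  have cpt: "compact (?F K)" if "compact K" for K
    unfolding hutchinson_def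
    by (intro compact_UN compact_continuous_image cont that) auto
  have cptk: "compact ((?F ^^ k) K)" if "compact K" for K k
    by (induction k) (simp_all add: that cpt)
  have ne: "?F K \<noteq> {}" if "K \<noteq> {}" for K
    unfolding hutchinson_def using that N by auto
  have nek: "(?F ^^ k) K \<noteq> {}" if "K \<noteq> {}" for K k
    by (induction k) (simp_all add: that ne)
  have D: "compact D" "D \<noteq> {}" unfolding D_def using R0 by auto
  have dec: "(?F ^^ Suc k) D \<subseteq> (?F ^^ k) D" for k
    unfolding funpow_Suc_right o_apply by (rule iterate_hutchinson_mono[OF FD])
  have anti: "(?F ^^ n) D \<subseteq> (?F ^^ m) D" if "m \<le> n" for m n
    using lift_Suc_antimono_le[of "\<lambda>k. (?F ^^ k) D", OF dec that] .
  have Ane: "A \<noteq> {}"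
    unfolding A_def by (rule compact_nest[OF cptk[OF D(1)] nek[OF D(2)] anti])
  have "A \<subseteq> (?F ^^ 0) D" unfolding A_def by (rule INF_lower) simp
  then have AD: "A \<subseteq> D" by simp
  have Acl: "closed A"
    unfolding A_def using cptk[OF D(1)] by (auto intro: compact_imp_closed)
  have Ac: "compact A"
    using compact_Int_closed[OF D(1) Acl] AD by (simp add: Int_absorb1)
  have FA: "?F A \<subseteq> A"
  proof -
    have "?F A \<subseteq> (?F ^^ k) D" for k
    proof -
      have "A \<subseteq> (?F ^^ k) D" unfolding A_def by blast
      then have "?F A \<subseteq> (?F ^^ Suc k) D" using hutchinson_mono by simp
      also have "\<dots> \<subseteq> (?F ^^ k) D" by (rule dec)
      finally show ?thesis .
    qed
    then show ?thesis unfolding A_def by blast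
  qed
  have FAk: "(?F ^^ k) A \<subseteq> A" for k
  proof (induction k)
    case (Suc k)
    have "(?F ^^ Suc k) A \<subseteq> ?F A" using hutchinson_mono[OF Suc] by simp
    with FA show ?case by blast
  qed simp
  have "(\<lambda>k. hausdorff_dist ((?F ^^ k) K) A) \<longlonglongrightarrow> 0" if K: "compact K" "K \<noteq> {}" for K
  proof -
    have "bounded (K \<union> D)" using K D by (simp add: compact_imp_bounded)
    then obtain C where C: "\<And>x y. x \<in> K \<union> D \<Longrightarrow> y \<in> K \<union> D \<Longrightarrow> dist x y \<le> C"
      unfolding bounded_two_points by blast
    have KA: "\<exists>a\<in>A. dist x a \<le> C" if "x \<in> K" for x
      using Ane AD C that by blast
    have DK: "\<exists>y\<in>K. dist x y \<le> C" if "x \<in> D" for x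
      using K(2) C that by blast
    have 1: "\<exists>a\<in>A. dist x a \<le> c ^ k * C" if "x \<in> (?F ^^ k) K" for x k
      using iterate_hutchinson_close[OF contr c(1) KA that] FAk by blast
    have 2: "\<exists>y\<in>(?F ^^ k) K. dist a y \<le> c ^ k * C" if "a \<in> A" for a k
      using iterate_hutchinson_close[OF contr c(1) DK, where x = a and k = k] that unfolding A_def by blast
    have lim: "(\<lambda>k. c ^ k * C) \<longlonglongrightarrow> 0"
      using tendsto_mult_left_zero[OF LIMSEQ_power_zero, of c C] c by simp
    show ?thesis
    proof (rule tendsto_sandwich[OF _ _ tendsto_const lim])
      show "\<forall>\<^sub>F k in sequentially. 0 \<le> hausdorff_dist ((?F ^^ k) K) A"
        by (rule always_eventually, rule allI, rule hausdorff_dist_bounds(1)[OF nek[OF K(2)] Ane 1 2])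
      show "\<forall>\<^sub>F k in sequentially. hausdorff_dist ((?F ^^ k) K) A \<le> c ^ k * C"
        by (rule always_eventually, rule allI, rule hausdorff_dist_bounds(2)[OF nek[OF K(2)] Ane 1 2])
    qed
  qed
  then have "is_attractor N f q t A" unfolding is_attractor_def using Ac Ane by blast
  then show ?thesis using FA that by blast
qed

text \<open>The supremum \<open>d\<close> of the distances from points of \<open>B\<close> to \<open>A\<close> satisfies \<open>d \<le> c * d\<close>:
  a point \<open>w y\<close> is at most \<open>c\<close> times as far from \<open>A\<close> as \<open>y\<close> is. The map \<open>w\<close> may depend on
  the point, so infinitely many maps can occur.\<close>

lemma subset_of_contracting_cover:
  fixes A B :: "'a::heine_borel set"
  assumes "bounded B" and A: "closed A" "A \<noteq> {}" and c: "0 \<le> c" "c < 1"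
    and cover: "\<And>x. x \<in> B \<Longrightarrow> \<exists>w. \<exists>y\<in>B. x = w y \<and> w ` A \<subseteq> A \<and>
                  (\<forall>u v. dist (w u) (w v) \<le> c * dist u v)"
  shows "B \<subseteq> A"
proof (cases "B = {}")
  case False
  define d where "d = (SUP x\<in>B. infdist x A)"
  obtain a where a: "a \<in> A" using A(2) by blast
  obtain e where e: "\<And>x. x \<in> B \<Longrightarrow> dist x a \<le> e"
    using \<open>bounded B\<close> unfolding bounded_any_center[where a = a] by (auto simp: dist_commute)
  have bdd: "bdd_above ((\<lambda>x. infdist x A) ` B)"
    using infdist_le2[OF a e] by (auto intro!: bdd_aboveI)
  have up: "infdist x A \<le> d" if "x \<in> B" for x
    unfolding d_def by (rule cSUP_upper[OF that bdd])
  have "infdist x A \<le> c * d" if x: "x \<in> B" for x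
  proof -
    from cover[OF x] obtain w y where y: "y \<in> B" and w: "x = w y" "w ` A \<subseteq> A"
      "\<And>u v. dist (w u) (w v) \<le> c * dist u v" by blast
    obtain p where p: "p \<in> A" "infdist y A = dist y p" using infdist_attains_inf[OF A] .
    have "infdist x A \<le> dist x (w p)" using p(1) w(2) by (auto intro: infdist_le)
    also have "\<dots> \<le> c * infdist y A" using w(1,3) p(2) by simp
    also have "\<dots> \<le> c * d" by (rule mult_left_mono[OF up[OF y] c(1)])
    finally show ?thesis .
  qed
  then have "d \<le> c * d" unfolding d_def[symmetric] using False
    by (subst d_def) (rule cSUP_least)
  then have "d * (1 - c) \<le> 0" by (simp add: algebra_simps)
  then have "d \<le> 0" using c by (simp add: mult_le_0_iff)
  then have "infdist x A = 0" if "x \<in> B" for x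
    using up[OF that] infdist_nonneg[of x A] by linarith
  then show ?thesis using in_closed_iff_infdist_zero[OF A] by blast
qed simp

section \<open>Rotations of the plane\<close>

definition rot :: "real \<Rightarrow> real^2^2" where
  "rot \<theta> = vector [vector [cos \<theta>, - sin \<theta>], vector [sin \<theta>, cos \<theta>]]"

lemma rot_apply: "rot \<theta> *v x = vector [cos \<theta> * x$1 - sin \<theta> * x$2, sin \<theta> * x$1 + cos \<theta> * x$2]"
  by (simp add: rot_def vec_eq_iff forall_2 matrix_vector_mult_def sum_2 vector_2)

lemma norm_real2: "norm (x::real^2) = sqrt ((x$1)\<^sup>2 + (x$2)\<^sup>2)"
  by (simp add: norm_vec_def L2_set_def sum_2)

lemma rot_add: "rot \<alpha> *v (rot \<beta> *v x) = rot (\<alpha> + \<beta>) *v x"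
  by (simp add: rot_apply vec_eq_iff forall_2 vector_2 cos_add sin_add algebra_simps)

lemma rot_zero: "rot 0 *v x = x"
  by (simp add: rot_apply vec_eq_iff forall_2 vector_2)

lemma rot_period: "rot (\<alpha> - 2 * pi * of_int h) = rot \<alpha>"
proof -
  have "cos (\<alpha> - 2 * pi * of_int h) = cos \<alpha>" "sin (\<alpha> - 2 * pi * of_int h) = sin \<alpha>"
    using cos_int_2pin[of h] sin_int_2pin[of h] by (simp_all add: cos_diff sin_diff mult.commute)
  then show ?thesis by (simp add: rot_def)
qed

lemma norm_rot: "norm (rot \<theta> *v x) = norm x"
proof -
  have "(cos \<theta> * x$1 - sin \<theta> * x$2)\<^sup>2 + (sin \<theta> * x$1 + cos \<theta> * x$2)\<^sup>2
          = ((sin \<theta>)\<^sup>2 + (cos \<theta>)\<^sup>2) * ((x$1)\<^sup>2 + (x$2)\<^sup>2)"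
    by algebra
  then show ?thesis by (simp add: norm_real2 rot_apply vector_2)
qed

lemma rot_lipschitz: "norm (rot \<alpha> *v x - rot \<beta> *v x) \<le> \<bar>\<alpha> - \<beta>\<bar> * norm x"
proof -
  have "(norm (rot \<alpha> *v x - rot \<beta> *v x))\<^sup>2
          = ((cos \<alpha> - cos \<beta>)\<^sup>2 + (sin \<alpha> - sin \<beta>)\<^sup>2) * (norm x)\<^sup>2"
    by (simp add: norm_real2 rot_apply vector_2) algebra
  also have "(cos \<alpha> - cos \<beta>)\<^sup>2 + (sin \<alpha> - sin \<beta>)\<^sup>2
     = (2 * sin ((\<alpha> - \<beta>) / 2))\<^sup>2 * ((sin ((\<alpha> + \<beta>) / 2))\<^sup>2 + (cos ((\<alpha> + \<beta>) / 2))\<^sup>2)"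
  proof -
    have "sin ((\<beta> - \<alpha>) / 2) = - sin ((\<alpha> - \<beta>) / 2)"
      by (metis minus_diff_eq minus_divide_left sin_minus)
    then show ?thesis unfolding cos_diff_cos sin_diff_sin
      by (simp add: power_mult_distrib distrib_left del: sin_cos_squared_add)
  qed
  also have "\<dots> = (2 * sin ((\<alpha> - \<beta>) / 2))\<^sup>2" by simp
  finally have "(norm (rot \<alpha> *v x - rot \<beta> *v x))\<^sup>2 = (2 * \<bar>sin ((\<alpha> - \<beta>) / 2)\<bar> * norm x)\<^sup>2"
    by (simp add: power_mult_distrib)
  then have "norm (rot \<alpha> *v x - rot \<beta> *v x) = 2 * \<bar>sin ((\<alpha> - \<beta>) / 2)\<bar> * norm x"
    by (rule power2_eq_imp_eq) simp_all
  also have "\<dots> \<le> \<bar>\<alpha> - \<beta>\<bar> * norm x"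
    using abs_sin_x_le_abs_x[of "(\<alpha> - \<beta>) / 2"] by (intro mult_right_mono) auto
  finally show ?thesis .
qed

text \<open>The cosine and sine of the angle from \<open>x\<close> to \<open>y\<close> are the normalised scalar and cross
  products; that their squares add up to 1 is Lagrange's identity.\<close>

lemma rot_transitive:
  assumes "norm y = norm x" and "x \<noteq> 0"
  obtains \<phi> where "y = rot \<phi> *v x"
proof -
  let ?n = "(norm x)\<^sup>2"
  define a where "a = (x$1 * y$1 + x$2 * y$2) / ?n"
  define b where "b = (x$1 * y$2 - x$2 * y$1) / ?n"
  have n: "?n \<noteq> 0" "?n = (x$1)\<^sup>2 + (x$2)\<^sup>2" "?n = (y$1)\<^sup>2 + (y$2)\<^sup>2"
    using assms by (simp, simp add: norm_real2, simp add: norm_real2 assms(1)[symmetric])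
  have "(x$1 * y$1 + x$2 * y$2)\<^sup>2 + (x$1 * y$2 - x$2 * y$1)\<^sup>2
      = ((x$1)\<^sup>2 + (x$2)\<^sup>2) * ((y$1)\<^sup>2 + (y$2)\<^sup>2)" by algebra
  then have "(x$1 * y$1 + x$2 * y$2)\<^sup>2 + (x$1 * y$2 - x$2 * y$1)\<^sup>2 = ?n\<^sup>2"
    using n(2,3) by (simp add: power2_eq_square)
  then have "a\<^sup>2 + b\<^sup>2 = 1"
    unfolding a_def b_def power_divide add_divide_distrib[symmetric] using n(1) by simp
  then obtain \<phi> where ab: "a = cos \<phi>" "b = sin \<phi>" using sincos_total_2pi by metis
  have "y$1 * ?n = (x$1 * y$1 + x$2 * y$2) * x$1 - (x$1 * y$2 - x$2 * y$1) * x$2"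
    "y$2 * ?n = (x$1 * y$2 - x$2 * y$1) * x$1 + (x$1 * y$1 + x$2 * y$2) * x$2"
    unfolding n(2) by (simp_all add: algebra_simps power2_eq_square)
  then have "y$1 = a * x$1 - b * x$2" "y$2 = b * x$1 + a * x$2"
    using n(1) unfolding a_def b_def times_divide_eq_left
      diff_divide_distrib[symmetric] add_divide_distrib[symmetric]
    by (metis nonzero_mult_div_cancel_right)+
  then have "y = rot \<phi> *v x" by (simp add: rot_apply vec_eq_iff forall_2 vector_2 ab)
  then show ?thesis by (rule that)
qed

text \<open>Kronecker's theorem gives for each angle a multiple of \<open>\<theta>\<close> close to it modulo a full turn.
  Compactness of the interval of fractional parts makes the bound \<open>M\<close> the same for all angles,
  so that it can be fixed before the scaling ratio is moved towards 1.\<close>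

lemma irrational_rotation_uniformly_dense:
  assumes irr: "\<theta> / pi \<notin> \<rat>" and e: "0 < e"
  obtains M :: nat where "\<And>\<phi>. \<exists>n\<le>M. \<exists>h::int. \<bar>real n * \<theta> - 2 * pi * h - \<phi>\<bar> \<le> e"
proof -
  define \<alpha> where "\<alpha> = \<theta> / (2 * pi)"
  have a: "\<alpha> \<notin> \<rat>"
  proof
    assume "\<alpha> \<in> \<rat>"
    then have "2 * \<alpha> \<in> \<rat>" by (intro Rats_mult) auto
    with irr show False by (simp add: \<alpha>_def)
  qed
  define \<epsilon> where "\<epsilon> = e / (2 * pi)"
  have eps: "0 < \<epsilon>" using e by (simp add: \<epsilon>_def)
  have "{0..1} \<subseteq> (\<Union>n\<in>UNIV. ball (frac (real n * \<alpha>)) \<epsilon>)"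
  proof
    fix x :: real assume "x \<in> {0..1}"
    then obtain n where "\<bar>frac (real n * \<alpha>) - x\<bar> < \<epsilon>"
      using Kronecker_approx_1_explicit[OF a _ _ eps, of x] by auto
    then show "x \<in> (\<Union>n\<in>UNIV. ball (frac (real n * \<alpha>)) \<epsilon>)" by (auto simp: dist_real_def)
  qed
  then obtain I where I: "finite I" "{0..1} \<subseteq> (\<Union>n\<in>I. ball (frac (real n * \<alpha>)) \<epsilon>)"
    using compactE_image[OF compact_Icc, of UNIV "\<lambda>n. ball (frac (real n * \<alpha>)) \<epsilon>" 0 1] by auto
  have "\<exists>n\<le>Max I. \<exists>h::int. \<bar>real n * \<theta> - 2 * pi * h - \<phi>\<bar> \<le> e" for \<phi>
  proof -
    let ?x = "\<phi> / (2 * pi)"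
    have "frac ?x \<in> {0..1}" using frac_lt_1[of ?x] by (simp add: less_imp_le)
    with I(2) have "frac ?x \<in> (\<Union>n\<in>I. ball (frac (real n * \<alpha>)) \<epsilon>)" by blast
    then obtain n where n: "n \<in> I" "\<bar>frac (real n * \<alpha>) - frac ?x\<bar> < \<epsilon>"
      by (auto simp: dist_real_def)
    let ?h = "\<lfloor>real n * \<alpha>\<rfloor> - \<lfloor>?x\<rfloor>"
    have "real n * \<theta> - 2 * pi * ?h - \<phi> = 2 * pi * (frac (real n * \<alpha>) - frac ?x)"
      by (simp add: frac_def \<alpha>_def field_simps)
    then have "\<bar>real n * \<theta> - 2 * pi * ?h - \<phi>\<bar> = 2 * pi * \<bar>frac (real n * \<alpha>) - frac ?x\<bar>"
      by (simp add: abs_mult)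
    also have "\<dots> \<le> 2 * pi * \<epsilon>" by (rule mult_left_mono) (use n(2) in auto)
    also have "\<dots> = e" by (simp add: \<epsilon>_def)
    finally show ?thesis using n(1) I(1) Max_ge by blast
  qed
  then show ?thesis by (rule that)
qed


section \<open>Covering a disc by its own images\<close>

text \<open>With \<open>c = g2 p - p\<close>, points within \<open>\<rho> * norm c\<close> of \<open>p\<close> are images under \<open>g1\<close>.
  For a point \<open>p + u\<close> further out, choose \<open>n \<le> M\<close> such that \<open>c\<close> turned by \<open>n * \<theta>\<close> has nearly
  the direction of \<open>u\<close>. Then \<open>u\<close> and the centre of the \<open>n\<close>-th image disc, taken relative
  to \<open>p\<close>, differ by at most \<open>\<sigma> / 8 * norm c\<close> for each of three reasons: the length of \<open>u\<close>, its
  direction, and the factor \<open>\<rho> ^ n\<close>. The image disc has radius at least \<open>\<sigma> / 2 * norm c\<close>.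
  All errors are bounded by multiples of \<open>norm c\<close>, so the same \<open>\<sigma>\<close> and \<open>M\<close> serve for
  arbitrarily small displacements \<open>c\<close>. The map \<open>g2\<close> may reverse the orientation.\<close>

lemma rotated_images_fill_disc:
  fixes p :: "real^2"
  assumes lam: "0 < \<rho>" "\<rho> < 1" and s: "0 < \<sigma>" "\<sigma> \<le> 1" "\<sigma> \<le> s"
    and dense: "\<And>\<phi>. \<exists>n\<le>M. \<exists>h::int. \<bar>real n * \<theta> - 2 * pi * h - \<phi>\<bar> \<le> \<sigma> / 8"
    and near1: "real (Suc M) * (1 - \<rho>) \<le> \<sigma> / 8"
    and g1: "\<And>x. g1 x = p + \<rho> *\<^sub>R (rot \<theta> *v (x - p))"
    and g2: "\<And>x y. norm (g2 x - g2 y) = s * norm (x - y)" "surj g2" "g2 p \<noteq> p"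
    and x: "x \<in> cball p (norm (g2 p - p))"
  shows "\<exists>y\<in>cball p (norm (g2 p - p)). x = g1 y \<or> (\<exists>n. x = (g1 ^^ n) (g2 y))"
proof -
  define c where "c = g2 p - p"
  define u where "u = x - p"
  have c0: "c \<noteq> 0" using g2(3) by (simp add: c_def)
  have u: "norm u \<le> norm c" using x by (simp add: u_def c_def dist_norm norm_minus_commute)
  have cball: "p + v \<in> cball p (norm (g2 p - p)) \<longleftrightarrow> norm v \<le> norm c" for v
    by (simp add: c_def dist_norm)
  have iter: "(g1 ^^ n) y = p + \<rho> ^ n *\<^sub>R (rot (real n * \<theta>) *v (y - p))" for n y
  proof (induction n)
    case (Suc n)
    have "(g1 ^^ Suc n) y = p + \<rho> *\<^sub>R (rot \<theta> *v (\<rho> ^ n *\<^sub>R (rot (real n * \<theta>) *v (y - p))))"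
      by (simp add: Suc g1)
    also have "\<dots> = p + \<rho> ^ Suc n *\<^sub>R (rot (real (Suc n) * \<theta>) *v (y - p))"
      by (simp add: matrix_vector_mult_scaleR rot_add algebra_simps)
    finally show ?case .
  qed (simp add: rot_zero)
  show ?thesis
  proof (cases "norm u \<le> \<rho> * norm c")
    case True
    let ?y = "p + (1 / \<rho>) *\<^sub>R (rot (- \<theta>) *v u)"
    have "norm ((1 / \<rho>) *\<^sub>R (rot (- \<theta>) *v u)) \<le> norm c"
      using True lam(1) by (simp add: norm_rot field_simps)
    then have "?y \<in> cball p (norm (g2 p - p))" unfolding cball .
    moreover have "x = g1 ?y"
      using lam(1) by (simp add: g1 matrix_vector_mult_scaleR rot_add rot_zero u_def)
    ultimately show ?thesis by blast
  next
    case False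
    define \<mu> where "\<mu> = norm u / norm c"
    have c_pos: "0 < norm c" using c0 by simp
    have "0 \<le> \<rho> * norm c" using lam(1) by simp
    then have "0 < norm u" using False by linarith
    then have mu: "\<rho> \<le> \<mu>" "\<mu> \<le> 1" "0 < \<mu>"
      using False u c_pos by (simp_all add: \<mu>_def pos_le_divide_eq pos_divide_le_eq c0)
    have "norm ((1 / \<mu>) *\<^sub>R u) = norm c"
      using \<open>0 < norm u\<close> by (simp add: \<mu>_def)
    then obtain \<phi> where phi: "(1 / \<mu>) *\<^sub>R u = rot \<phi> *v c" using rot_transitive c0 by metis
    have u_eq: "u = \<mu> *\<^sub>R (rot \<phi> *v c)"
      unfolding phi[symmetric] using mu(3) by simp
    obtain n h where n: "n \<le> M" and h: "\<bar>real n * \<theta> - 2 * pi * of_int h - \<phi>\<bar> \<le> \<sigma> / 8"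
      using dense by blast
    \<comment> \<open>Bernoulli's inequality turns the linear hypothesis \<open>near1\<close> into control of the powers.\<close>
    have "1 - real n * (1 - \<rho>) \<le> \<rho> ^ n"
      using Bernoulli_inequality[of "\<rho> - 1" n] lam by (simp add: algebra_simps)
    moreover have "real n * (1 - \<rho>) \<le> real (Suc M) * (1 - \<rho>)"
      using n lam by (intro mult_right_mono) auto
    ultimately have pow: "1 - \<rho> ^ n \<le> \<sigma> / 8" using near1 by linarith
    have "1 * (1 - \<rho>) \<le> real (Suc M) * (1 - \<rho>)"
      using lam by (intro mult_right_mono) auto
    from order_trans[OF this near1] have one: "1 - \<rho> \<le> \<sigma> / 8" by simp
    have pow1: "\<rho> ^ n \<le> 1" using lam by (simp add: power_le_one)
    let ?a = "rot \<phi> *v c" and ?b = "rot (real n * \<theta>) *v c"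
    have "u - \<rho> ^ n *\<^sub>R ?b = (\<mu> - 1) *\<^sub>R ?a + (?a - ?b) + (1 - \<rho> ^ n) *\<^sub>R ?b"
      by (simp add: u_eq algebra_simps)
    also have "norm \<dots> \<le> norm ((\<mu> - 1) *\<^sub>R ?a) + norm (?a - ?b) + norm ((1 - \<rho> ^ n) *\<^sub>R ?b)"
      by (rule order_trans[OF norm_triangle_ineq add_right_mono[OF norm_triangle_ineq]])
    also have "\<dots> \<le> \<sigma> / 8 * norm c + \<sigma> / 8 * norm c + \<sigma> / 8 * norm c"
    proof (intro add_mono)
      show "norm ((\<mu> - 1) *\<^sub>R ?a) \<le> \<sigma> / 8 * norm c"
        unfolding norm_scaleR norm_rot by (rule mult_right_mono) (use mu one in auto)
      show "norm ((1 - \<rho> ^ n) *\<^sub>R ?b) \<le> \<sigma> / 8 * norm c"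
        unfolding norm_scaleR norm_rot by (rule mult_right_mono) (use pow pow1 in auto)
      have "norm (?a - ?b) \<le> \<bar>\<phi> - (real n * \<theta> - 2 * pi * of_int h)\<bar> * norm c"
        using rot_lipschitz[of \<phi> c "real n * \<theta> - 2 * pi * of_int h"] by (simp only: rot_period)
      also have "\<dots> \<le> \<sigma> / 8 * norm c"
        by (rule mult_right_mono) (use h in \<open>simp_all only: abs_minus_commute norm_ge_zero\<close>)
      finally show "norm (?a - ?b) \<le> \<sigma> / 8 * norm c" .
    qed
    also have "\<dots> \<le> \<sigma> / 2 * norm c" using s(1) by simp
    also have "\<dots> \<le> \<rho> ^ n * s * norm c"
    proof (intro mult_right_mono)
      have "1 / 2 * \<sigma> \<le> \<rho> ^ n * s" by (intro mult_mono) (use pow s lam in auto)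
      then show "\<sigma> / 2 \<le> \<rho> ^ n * s" by simp
    qed simp
    finally have est: "norm (u - \<rho> ^ n *\<^sub>R ?b) \<le> \<rho> ^ n * s * norm c" .
    \<comment> \<open>Pull \<open>x\<close> back under \<open>g1 ^^ n\<close> and then under \<open>g2\<close>; the estimate says that the result
      lies in the disc.\<close>
    let ?v = "(1 / \<rho> ^ n) *\<^sub>R (rot (- (real n * \<theta>)) *v u)"
    obtain y where y: "g2 y = p + ?v" using g2(2) by (metis surjD)
    have xy: "x = (g1 ^^ n) (g2 y)"
      using lam(1) by (simp add: iter y matrix_vector_mult_scaleR rot_add rot_zero u_def)
    have "u = \<rho> ^ n *\<^sub>R (rot (real n * \<theta>) *v (g2 y - p))"
      unfolding u_def xy iter by simp
    then have "u - \<rho> ^ n *\<^sub>R ?b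
        = \<rho> ^ n *\<^sub>R (rot (real n * \<theta>) *v (g2 y - p) - ?b)"
      by (simp only: scaleR_diff_right)
    also have "\<dots> = \<rho> ^ n *\<^sub>R (rot (real n * \<theta>) *v (g2 y - g2 p))"
      by (simp add: c_def matrix_vector_mult_diff_distrib)
    finally have "norm (u - \<rho> ^ n *\<^sub>R ?b) = \<rho> ^ n * (s * norm (y - p))"
      using lam(1) by (simp add: norm_rot g2(1))
    with est have "(\<rho> ^ n * s) * norm (y - p) \<le> (\<rho> ^ n * s) * norm c" by (simp add: mult.assoc)
    moreover have "0 < \<rho> ^ n * s" using lam s by simp
    ultimately have "norm (y - p) \<le> norm c" by (rule mult_left_le_imp_le)
    then have "y \<in> cball p (norm (g2 p - p))" using cball[of "y - p"] by simp
    with xy show ?thesis by blast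
  qed
qed

section \<open>Families of similarities\<close>

lemma linear_part_eqI:
  assumes "\<And>x. g x = L *v x + a"
  shows "linear_part g = L"
  unfolding linear_part_def
proof (rule the_equality)
  show "\<exists>a. \<forall>x. g x = L *v x + a" using assms by blast
  fix L' assume "\<exists>a. \<forall>x. g x = L' *v x + a"
  then obtain b where b: "\<And>x. g x = L' *v x + b" by blast
  have "L' *v x = L *v x" for x
    using b[of x] b[of 0] assms[of x] assms[of 0] by simp
  then show "L' = L" by (simp add: matrix_eq)
qed

lemma scaling_ratio_eqI:
  assumes "\<And>x. norm (L *v x) = r * norm x"
  shows "scaling_ratio L = r"
  unfolding scaling_ratio_def
proof (rule the_equality)
  fix r' assume "\<forall>x. norm (L *v x) = r' * norm x"
  then show "r' = r" using assms[of "axis 1 1"] by simp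
qed (use assms in simp)

lemma onorm_conformal:
  fixes L :: "real^2^2"
  assumes "\<And>x. norm (L *v x) = r * norm x"
  shows "onorm ((*v) L) = r"
proof (rule antisym)
  show "onorm ((*v) L) \<le> r" by (rule onorm_le) (simp add: assms)
  have "norm (L *v axis 1 1) \<le> onorm ((*v) L) * norm (axis 1 1 :: real^2)"
    by (rule onorm) (rule matrix_vector_mul_bounded_linear)
  then show "r \<le> onorm ((*v) L)" by (simp add: assms)
qed

lemma norm_word_matrix:
  assumes "\<And>i x. i \<in> {1..N} \<Longrightarrow> norm (linear_part (f i) *v x) = r i * norm x"
    and "set w \<subseteq> {1..N}"
  shows "norm (word_matrix f w *v x) = prod_list (map r w) * norm x"
  using assms(2)
proof (induction w)
  case (Cons i w)
  then show ?case
    using assms(1)[of i "word_matrix f w *v x"]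
    by (simp add: word_matrix_def matrix_vector_mul_assoc[symmetric])
qed (simp add: word_matrix_def)

text \<open>For conformal linear parts the operator norm is multiplicative along words, so the maximum over
  words of length \<open>k\<close> is attained by repeating an index of largest ratio.\<close>

lemma joint_spectral_radius_conformal:
  assumes r: "\<And>i x. i \<in> {1..N} \<Longrightarrow> norm (linear_part (f i) *v x) = r i * norm x"
    and pos: "\<And>i. i \<in> {1..N} \<Longrightarrow> 0 \<le> r i"
    and m: "m \<in> {1..N}" and max: "\<And>i. i \<in> {1..N} \<Longrightarrow> r i \<le> r m"
  shows "joint_spectral_radius N f = r m"
proof -
  let ?W = "\<lambda>k. {w. length w = k \<and> set w \<subseteq> {1..N}}"
  have Mx: "Max ((\<lambda>w. onorm ((*v) (word_matrix f w))) ` ?W k) = r m ^ k" for k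
  proof (rule Max_eqI)
    show "finite ((\<lambda>w. onorm ((*v) (word_matrix f w))) ` ?W k)"
      using finite_lists_length_eq[of "{1..N}" k] by (simp add: conj_commute)
    have on: "onorm ((*v) (word_matrix f w)) = prod_list (map r w)" if "set w \<subseteq> {1..N}" for w
      by (rule onorm_conformal) (rule norm_word_matrix[OF r that])
    show "y \<le> r m ^ k" if y: "y \<in> (\<lambda>w. onorm ((*v) (word_matrix f w))) ` ?W k" for y
    proof -
      have "0 \<le> prod_list (map r w) \<and> prod_list (map r w) \<le> r m ^ length w"
        if "set w \<subseteq> {1..N}" for w
        using that by (induction w) (auto simp: pos pos[OF m, simplified] intro!: mult_mono max)
      then show ?thesis using y on by auto
    qed
    have "r m ^ k = onorm ((*v) (word_matrix f (replicate k m)))"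
      using on[of "replicate k m"] m by (simp add: prod_list_replicate set_replicate_conv_if)
    then show "r m ^ k \<in> (\<lambda>w. onorm ((*v) (word_matrix f w))) ` ?W k"
      using m by (intro image_eqI[of _ _ "replicate k m"]) (auto simp: set_replicate_conv_if)
  qed
  have "(\<lambda>k. ereal (root k (r m ^ k))) \<longlonglongrightarrow> ereal (r m)"
  proof (rule tendsto_eventually)
    show "\<forall>\<^sub>F k in sequentially. ereal (root k (r m ^ k)) = ereal (r m)"
      using eventually_gt_at_top[of 0] by eventually_elim (simp add: real_root_power_cancel pos[OF m])
  qed
  then have "limsup (\<lambda>k. ereal (root k (r m ^ k))) = ereal (r m)"
    by (rule lim_imp_Limsup[OF sequentially_bot])
  then show ?thesis unfolding joint_spectral_radius_def Mx by simp
qed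

text \<open>The conjugating bijection sends the origin, which linear functions fix, to a common fixed point
  of all \<open>fam f q i t\<close>. At \<open>t = 0\<close> the function is constant with value \<open>q i\<close>, so that
  fixed point is \<open>q i\<close>; any positive parameter then gives \<open>f i (q i) = 0\<close>.\<close>

lemma semi_linear_family_centres:
  assumes "semi_linear_family N f q" "0 < t0 N f" "i \<in> {1..N}"
  shows "f i (q i) = 0"
proof -
  from assms obtain h where h: "\<And>t. t \<in> {0..<t0 N f} \<Longrightarrow> \<exists>g. linear g \<and> conjugate_by h (fam f q i t) g"
    unfolding semi_linear_family_def by blast
  have fixpt: "fam f q i t (h 0) = h 0" if t: "t \<in> {0..<t0 N f}" for t
  proof -
    from h[OF t] obtain g where g: "linear g" "bij h" "g = inv h \<circ> fam f q i t \<circ> h"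
      unfolding conjugate_by_def by blast
    have "inv h (fam f q i t (h 0)) = 0" using linear_0[OF g(1)] g(3) by simp
    then show ?thesis using g(2) by (metis bij_inv_eq_iff)
  qed
  have "h 0 = q i" using fixpt[of 0] assms(2) by (simp add: fam_def)
  then show ?thesis using fixpt[of "t0 N f / 2"] assms(2) by (simp add: fam_def)
qed

lemma common_centre_imp_linear_family:
  assumes lin: "\<And>i x. i \<in> {1..N} \<Longrightarrow> f i x = L i *v (x - q i)"
    and p: "\<And>i. i \<in> {1..N} \<Longrightarrow> q i = p"
  shows "linear_family N f q"
  unfolding linear_family_def
proof (rule exI[of _ "\<lambda>x. x + p"], intro ballI)
  fix i t assume i: "i \<in> {1..N}"
  let ?h = "\<lambda>x::real^2. x + p" and ?g = "\<lambda>x. t *\<^sub>R (L i *v x)"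
  have b: "bij ?h" by (rule bij_betwI[where g = "\<lambda>x. x - p"]) auto
  have "?g = inv ?h \<circ> fam f q i t \<circ> ?h"
  proof
    fix x
    have "?h (?g x) = fam f q i t (?h x)" using lin[OF i, of "x + p"] p[OF i] by (simp add: fam_def)
    then show "?g x = (inv ?h \<circ> fam f q i t \<circ> ?h) x" using b by (simp add: bij_inv_eq_iff)
  qed
  moreover have "linear ?g" by (intro linear_compose_scale_right matrix_vector_mul_linear)
  ultimately show "\<exists>g. linear g \<and> conjugate_by ?h (fam f q i t) g"
    unfolding conjugate_by_def using b by blast
qed

lemma similarity_family_linear_parts:
  assumes "affine_family N f" "similarity_family N f q" "i \<in> {1..N}"
  obtains L a r where "\<And>x. f i x = L *v x + a" "invertible L" "0 < r"
    "\<And>x. norm (L *v x) = r * norm x"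
proof -
  from assms obtain L a where L: "invertible L" "\<And>x. f i x = L *v x + a"
    unfolding affine_family_def affine_map_def by blast
  from assms(2,3) have "similarity_map (fam f q i 1)" unfolding similarity_family_def by simp
  then obtain r where r: "0 < r" "\<And>x y. dist (fam f q i 1 x) (fam f q i 1 y) = r * dist x y"
    unfolding similarity_map_def by blast
  have "norm (L *v x) = r * norm x" for x
    using r(2)[of x 0] by (simp add: fam_def L(2) dist_norm)
  then show ?thesis using that L r(1) by blast
qed

theorem corollary7p1:
  fixes N :: nat and f :: "nat \<Rightarrow> real^2 \<Rightarrow> real^2" and q :: "nat \<Rightarrow> real^2"
  assumes "affine_family N f"
    and "similarity_family N f q"
    and "semi_linear_family N f q"
    and "\<not> linear_family N f q"
    and "\<exists>t\<in>{0..<t0 N f}. \<exists>i\<in>{1..N}.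
           (\<forall>j\<in>{1..N}. scaling_ratio (linear_part (fam f q j t))
                         \<le> scaling_ratio (linear_part (fam f q i t))) \<and>
           (\<exists>\<theta>. has_rotation_angle (linear_part (fam f q i t)) \<theta> \<and> \<theta> / pi \<notin> \<rat>)"
  shows "\<exists>\<tau>. 0 \<le> \<tau> \<and> \<tau> < t0 N f \<and>
           (\<forall>t. \<tau> < t \<and> t < t0 N f \<longrightarrow>
              (\<exists>A. is_attractor N f q t A \<and> interior A \<noteq> {}))"
proof -
  have "\<forall>i. \<exists>L a r. i \<in> {1..N} \<longrightarrow> (\<forall>x. f i x = L *v x + a) \<and> invertible L \<and> 0 < r \<and>
          (\<forall>x. norm (L *v x) = r * norm x)"
    using similarity_family_linear_parts[OF assms(1,2)] by metis
  then obtain L a r where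
    fL: "\<And>i x. i \<in> {1..N} \<Longrightarrow> f i x = L i *v x + a i" and
    inv: "\<And>i. i \<in> {1..N} \<Longrightarrow> invertible (L i)" and
    rpos: "\<And>i. i \<in> {1..N} \<Longrightarrow> 0 < r i" and
    normL: "\<And>i x. i \<in> {1..N} \<Longrightarrow> norm (L i *v x) = r i * norm x"
    by metis
  have lp: "linear_part (f i) = L i" if "i \<in> {1..N}" for i
    by (rule linear_part_eqI) (rule fL[OF that])
  have lpt: "linear_part (fam f q i t) = t *\<^sub>R L i" if "i \<in> {1..N}" for i t
    by (rule linear_part_eqI[where a = "t *\<^sub>R a i + q i"])
       (simp add: fam_def fL[OF that] scaleR_add_right scaleR_matrix_vector_assoc)
  obtain t m \<theta> where t: "0 \<le> t" and m: "m \<in> {1..N}"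
    and max: "\<And>j. j \<in> {1..N} \<Longrightarrow> scaling_ratio (t *\<^sub>R L j) \<le> scaling_ratio (t *\<^sub>R L m)"
    and rotm: "has_rotation_angle (t *\<^sub>R L m) \<theta>" and irr: "\<theta> / pi \<notin> \<rat>"
    using assms(5) lpt by auto
  have norm_t: "norm (t *\<^sub>R L i *v x) = (t * r i) * norm x" if "i \<in> {1..N}" for i x
    using t normL[OF that] by (simp flip: scaleR_matrix_vector_assoc)
  obtain k where k: "0 < k" "t *\<^sub>R L m = k *\<^sub>R rot \<theta>"
    using rotm unfolding has_rotation_angle_def rot_def by blast
  have "k = t * r m"
    using norm_t[OF m, of "axis 1 1"] k(1) unfolding k(2)
    by (simp add: norm_rot flip: scaleR_matrix_vector_assoc)
  with k(1) t rpos[OF m] have tpos: "0 < t" and "t *\<^sub>R L m = t *\<^sub>R (r m *\<^sub>R rot \<theta>)"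
    using k(2) by (auto simp: zero_less_mult_iff)
  then have Lm: "L m = r m *\<^sub>R rot \<theta>" by (metis less_irrefl scaleR_left_imp_eq)
  have rmax: "r j \<le> r m" if "j \<in> {1..N}" for j
    using max[OF that] tpos scaling_ratio_eqI[OF norm_t[OF that]] scaling_ratio_eqI[OF norm_t[OF m]]
    by simp
  have "joint_spectral_radius N f = r m"
    by (rule joint_spectral_radius_conformal[where r = r])
       (use lp normL rpos m rmax in \<open>auto intro: less_imp_le\<close>)
  then have t0: "t0 N f = 1 / r m" by (simp add: t0_def)
  have t0pos: "0 < t0 N f" using rpos[OF m] t0 by simp
  have centred: "f i x = L i *v (x - q i)" if "i \<in> {1..N}" for i x
    using semi_linear_family_centres[OF assms(3) t0pos that] fL[OF that]
    by (simp add: matrix_vector_mult_diff_distrib eq_neg_iff_add_eq_0[symmetric] add.commute)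
  obtain j where j: "j \<in> {1..N}" "q j \<noteq> q m"
    using common_centre_imp_linear_family[of N f L q "q m"] centred assms(4) by blast
  \<comment> \<open>The ratio of the second function is at least \<open>\<sigma>\<close> for all \<open>t \<ge> t0 N f / 2\<close>.\<close>
  define \<sigma> where "\<sigma> = r j / (2 * r m)"
  have s: "0 < \<sigma>" "\<sigma> \<le> 1" using rpos[OF m] rpos[OF j(1)] rmax[OF j(1)] by (auto simp: \<sigma>_def)
  obtain M where M: "\<And>\<phi>. \<exists>n\<le>M. \<exists>h::int. \<bar>real n * \<theta> - 2 * pi * h - \<phi>\<bar> \<le> \<sigma> / 8"
    using irrational_rotation_uniformly_dense[OF irr, of "\<sigma> / 8"] s(1) by auto
  \<comment> \<open>\<open>M\<close> does not depend on the scaling parameter, so \<open>\<delta>\<close>, the admissible defect of the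
    largest ratio from 1, can be chosen small in terms of \<open>\<sigma>\<close> and \<open>M\<close>.\<close>
  define \<delta> where "\<delta> = \<sigma> / (8 * real (Suc M))"
  have "\<sigma> \<le> real (Suc M)" using s by simp
  then have d: "0 < \<delta>" "\<delta> \<le> 1 / 2" "real (Suc M) * \<delta> = \<sigma> / 8"
    using s by (auto simp: \<delta>_def divide_simps)
  show ?thesis
  proof (intro exI[of _ "(1 - \<delta>) / r m"] conjI allI impI)
    show "0 \<le> (1 - \<delta>) / r m" "(1 - \<delta>) / r m < t0 N f"
      using d rpos[OF m] by (auto simp: t0 divide_simps)
    fix t assume "(1 - \<delta>) / r m < t \<and> t < t0 N f"
    then have l: "1 - \<delta> < t * r m" "t * r m < 1" using rpos[OF m] by (auto simp: t0 field_simps)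
    then have "0 < t * r m" using d by linarith
    then have tp: "0 < t" using rpos[OF m] by (simp add: zero_less_mult_iff)
    have dist_fam: "dist (fam f q i t x) (fam f q i t y) = t * r i * dist x y" if "i \<in> {1..N}" for i x y
    proof -
      have "fam f q i t x - fam f q i t y = t *\<^sub>R (L i *v (x - y))"
        by (simp add: fam_def centred[OF that] matrix_vector_mult_diff_distrib algebra_simps)
      then show ?thesis using tp normL[OF that] by (simp add: dist_norm)
    qed
    have contr: "dist (fam f q i t x) (fam f q i t y) \<le> t * r m * dist x y" if "i \<in> {1..N}" for i x y
      using tp rmax[OF that] by (simp add: dist_fam[OF that] mult_left_mono mult_right_mono)
    have "1 \<le> N" using m by simp
    then obtain A where A: "is_attractor N f q t A" "hutchinson N f q t A \<subseteq> A"
      using contracting_family_attractor[OF _ _ l(2) contr] \<open>0 < t * r m\<close> less_imp_le by metis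
    have inA: "fam f q i t ` A \<subseteq> A" if "i \<in> {1..N}" for i
      using A(2) that unfolding hutchinson_def by blast
    let ?g1 = "fam f q m t" and ?g2 = "fam f q j t" and ?p = "q m"
    let ?B = "cball ?p (norm (?g2 ?p - ?p))"
    have g1: "?g1 x = ?p + (t * r m) *\<^sub>R (rot \<theta> *v (x - ?p))" for x
      by (simp add: fam_def centred[OF m] Lm flip: scaleR_matrix_vector_assoc)
    have sj: "\<sigma> \<le> t * r j"
    proof -
      have "1 / (2 * r m) \<le> t" using l(1) d(2) rpos[OF m] by (simp add: field_simps)
      then have "1 / (2 * r m) * r j \<le> t * r j" by (rule mult_right_mono) (use rpos[OF j(1)] in simp)
      then show ?thesis by (simp add: \<sigma>_def)
    qed
    have g2n: "norm (?g2 x - ?g2 y) = t * r j * norm (x - y)" for x y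
      using dist_fam[OF j(1)] by (simp add: dist_norm)
    obtain L' where L': "L j ** L' = mat 1" using inv[OF j(1)] unfolding invertible_def by blast
    have surj: "surj ?g2"
    proof (rule surjI)
      fix y
      have "L j *v (L' *v ((1 / t) *\<^sub>R (y - q j))) = (1 / t) *\<^sub>R (y - q j)"
        by (simp only: matrix_vector_mul_assoc L' matrix_vector_mul_lid)
      then show "?g2 (q j + L' *v ((1 / t) *\<^sub>R (y - q j))) = y"
        using tp by (simp add: fam_def centred[OF j(1)])
    qed
    \<comment> \<open>A contraction has only one fixed point, and that of \<open>?g2\<close> is \<open>q j\<close>.\<close>
    have moved: "?g2 ?p \<noteq> ?p"
    proof
      assume "?g2 ?p = ?p"
      moreover have "?g2 (q j) = q j" by (simp add: fam_def centred[OF j(1)])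
      ultimately have "norm (?p - q j) = t * r j * norm (?p - q j)" using g2n[of ?p "q j"] by simp
      moreover have "t * r j \<le> t * r m" using rmax[OF j(1)] tp by simp
      ultimately show False using l(2) j(2) by simp
    qed
    have near1: "real (Suc M) * (1 - t * r m) \<le> \<sigma> / 8"
      unfolding d(3)[symmetric] by (rule mult_left_mono) (use l in auto)
    have "?B \<subseteq> A"
    proof (rule subset_of_contracting_cover[where c = "t * r m"])
      show "closed A" "A \<noteq> {}"
        using A(1) unfolding is_attractor_def by (auto intro: compact_imp_closed)
      fix x assume "x \<in> ?B"
      then obtain y where y: "y \<in> ?B" "x = ?g1 y \<or> (\<exists>n. x = (?g1 ^^ n) (?g2 y))"
        using rotated_images_fill_disc[OF \<open>0 < t * r m\<close> l(2) s sj M near1 g1 g2n surj moved] by blast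
      from y(2) show "\<exists>w. \<exists>y\<in>?B. x = w y \<and> w ` A \<subseteq> A \<and>
          (\<forall>u v. dist (w u) (w v) \<le> t * r m * dist u v)"
      proof
        assume "x = ?g1 y"
        then show ?thesis using y(1) inA[OF m] contr[OF m] by blast
      next
        assume "\<exists>n. x = (?g1 ^^ n) (?g2 y)"
        then obtain n where n: "x = (?g1 ^^ n) (?g2 y)" by blast
        have "(?g1 ^^ n) a \<in> A" if "a \<in> A" for a
          using inA[OF m] that by (induction n) auto
        then have "(\<lambda>z. (?g1 ^^ n) (?g2 z)) ` A \<subseteq> A" using inA[OF j(1)] by blast
        moreover have "dist ((?g1 ^^ n) u) ((?g1 ^^ n) v) \<le> dist u v" for u v
        proof (induction n)
          case (Suc n)
          have "dist ((?g1 ^^ Suc n) u) ((?g1 ^^ Suc n) v)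
                  \<le> t * r m * dist ((?g1 ^^ n) u) ((?g1 ^^ n) v)"
            using contr[OF m] by simp
          also have "\<dots> \<le> 1 * dist ((?g1 ^^ n) u) ((?g1 ^^ n) v)"
            by (rule mult_right_mono) (use l in auto)
          finally show ?case using Suc by simp
        qed simp
        then have "dist ((?g1 ^^ n) (?g2 u)) ((?g1 ^^ n) (?g2 v)) \<le> t * r m * dist u v" for u v
          using contr[OF j(1)] order_trans by blast
        ultimately show ?thesis using y(1) n
          by (intro exI[of _ "\<lambda>z. (?g1 ^^ n) (?g2 z)"] bexI[of _ y]) simp_all
      qed
    qed (use \<open>0 < t * r m\<close> l in auto)
    then have "interior ?B \<subseteq> interior A" by (rule interior_mono)
    moreover have "?p \<in> interior ?B" using moved by (simp add: interior_cball)
    ultimately show "\<exists>A. is_attractor N f q t A \<and> interior A \<noteq> {}" using A(1) by blast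
  qed
qed

end
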